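(* Let $E$ be a row-finite graph, $T_E$ its talented monoid, and $I$ a regular $\mathbb Z$-order ideal of $T_E$. If $\mathbb Z$ acts freely on $T_E$, then $\mathbb Z$ acts freely on $T_E/I$ as well.
   Context: A graph $E=(E^0,E^1,r,s)$ is a directed graph with countable vertex set $E^0$, countable edge set $E^1$, and range and source maps $r,s:E^1\to E^0$. It is row-finite if $s^{-1}(v)$ is finite for every vertex $v$. A vertex $v$ is regular if $s^{-1}(v)\ne\varnothing$. The talented monoid $T_E$ is the commutative monoid generated by $\{v(i)\mid v\in E^0,i\in\mathbb Z\}$ subject to $v(i)=\sum_{e\in s^{-1}(v)}r(e)(i+1)$ for all $i\in\mathbb Z$ and all regular vertices $v$; $\mathbb Z$ acts by ${}^n v(i)=v(i+n)$. On a commutative monoid, $a\le b$ iff $b=a+c$ for some $c$. A $\mathbb Z$-order ideal of $T_E$ is a submonoid $I$ closed under the $\mathbb Z$-action and such that $x\in I$, $y\le x$ imply $y\in I$. For a $\mathbb Z$-order ideal $I$, $I^\perp$ consists of $0$ together with all nonzero $a\in T_E$ such that for every nonzero $b\in I$ neither $a\le b$ nor $b\le a$; $I^\perp$ is again a $\mathbb Z$-order ideal. $I$ is regular if $I^{\perp\perp}=I$. The quotient $T_E/I$ is the quotient monoid by the congruence $a\equiv b$ iff $a+i=b+j$ for some $i,j\in I$, with the induced $\mathbb Z$-action. The group $\mathbb Z$ acts freely on a $\mathbb Z$-monoid $M$ if ${}^n a=a$ with $a\neq0$ implies $n=0$. *)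

theory Defs
  imports
    "HOL-Library.Multiset"
    "HOL-Library.Countable_Set"
    "HOL-Algebra.Divisibility"
    "Graph_Theory.Digraph"
begin

text \<open>
  Commutative monoids are HOL-Algebra monoids and hence written multiplicatively: \<open>\<one>\<close> plays the
  role of \<open>0\<close> and \<open>\<otimes>\<close> that of \<open>+\<close>. The algebraic preorder (\<open>a \<le> b\<close> iff \<open>b = a + c\<close> for some
  \<open>c\<close>) is then the library relation \<open>a divides b\<close>.
\<close>

section \<open>Monoids with an action of the integers\<close>

locale int_monoid = comm_monoid M for M (structure) +
  fixes act :: "int \<Rightarrow> 'a \<Rightarrow> 'a"
  assumes act_closed: "a \<in> carrier M \<Longrightarrow> act n a \<in> carrier M"
    and act_zero: "a \<in> carrier M \<Longrightarrow> act 0 a = a"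
    and act_add: "a \<in> carrier M \<Longrightarrow> act (m + n) a = act m (act n a)"
    and act_one: "act n \<one> = \<one>"
    and act_mult: "\<lbrakk>a \<in> carrier M; b \<in> carrier M\<rbrakk> \<Longrightarrow> act n (a \<otimes> b) = act n a \<otimes> act n b"

definition acts_freely :: "('a, 'm) monoid_scheme \<Rightarrow> (int \<Rightarrow> 'a \<Rightarrow> 'a) \<Rightarrow> bool" where
  "acts_freely M act \<longleftrightarrow>
     (\<forall>n. \<forall>a \<in> carrier M. a \<noteq> \<one>\<^bsub>M\<^esub> \<longrightarrow> act n a = a \<longrightarrow> n = 0)"

definition order_ideal :: "('a, 'm) monoid_scheme \<Rightarrow> (int \<Rightarrow> 'a \<Rightarrow> 'a) \<Rightarrow> 'a set \<Rightarrow> bool" where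
  "order_ideal M act I \<longleftrightarrow>
     submonoid I M \<and>
     (\<forall>n. \<forall>x \<in> I. act n x \<in> I) \<and>
     (\<forall>x \<in> I. \<forall>y \<in> carrier M. y divides\<^bsub>M\<^esub> x \<longrightarrow> y \<in> I)"

definition perp :: "('a, 'm) monoid_scheme \<Rightarrow> 'a set \<Rightarrow> 'a set" where
  "perp M I = {\<one>\<^bsub>M\<^esub>} \<union>
     {a \<in> carrier M. a \<noteq> \<one>\<^bsub>M\<^esub> \<and>
        (\<forall>b \<in> I. b \<noteq> \<one>\<^bsub>M\<^esub> \<longrightarrow> \<not> a divides\<^bsub>M\<^esub> b \<and> \<not> b divides\<^bsub>M\<^esub> a)}"

definition regular_order_ideal ::
  "('a, 'm) monoid_scheme \<Rightarrow> (int \<Rightarrow> 'a \<Rightarrow> 'a) \<Rightarrow> 'a set \<Rightarrow> bool" where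
  "regular_order_ideal M act I \<longleftrightarrow> order_ideal M act I \<and> perp M (perp M I) = I"

section \<open>Quotients by congruences\<close>

definition monoid_congruence :: "('a, 'm) monoid_scheme \<Rightarrow> 'a rel \<Rightarrow> bool" where
  "monoid_congruence M R \<longleftrightarrow> equiv (carrier M) R \<and>
     (\<forall>a b c d. (a, b) \<in> R \<longrightarrow> (c, d) \<in> R \<longrightarrow> (a \<otimes>\<^bsub>M\<^esub> c, b \<otimes>\<^bsub>M\<^esub> d) \<in> R)"

definition quot_monoid :: "('a, 'm) monoid_scheme \<Rightarrow> 'a rel \<Rightarrow> 'a set monoid" where
  "quot_monoid M R =
     \<lparr>carrier = carrier M // R,
      mult = (\<lambda>A B. \<Union>a\<in>A. \<Union>b\<in>B. R `` {a \<otimes>\<^bsub>M\<^esub> b}),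
      one = R `` {\<one>\<^bsub>M\<^esub>}\<rparr>"

definition quot_act :: "'a rel \<Rightarrow> (int \<Rightarrow> 'a \<Rightarrow> 'a) \<Rightarrow> int \<Rightarrow> 'a set \<Rightarrow> 'a set" where
  "quot_act R act n A = (\<Union>a\<in>A. R `` {act n a})"

lemma quot_mult_class:
  assumes R: "monoid_congruence M R" and "a \<in> carrier M" "b \<in> carrier M"
  shows "R `` {a} \<otimes>\<^bsub>quot_monoid M R\<^esub> R `` {b} = R `` {a \<otimes>\<^bsub>M\<^esub> b}"
proof -
  have eq: "equiv (carrier M) R"
    and R': "\<And>a b c d. (a, b) \<in> R \<Longrightarrow> (c, d) \<in> R \<Longrightarrow> (a \<otimes>\<^bsub>M\<^esub> c, b \<otimes>\<^bsub>M\<^esub> d) \<in> R"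
    using R by (auto simp: monoid_congruence_def)
  have self: "a \<in> R `` {a}" "b \<in> R `` {b}"
    using equiv_class_self[OF eq] assms(2,3) by blast+
  have "R `` {x \<otimes>\<^bsub>M\<^esub> y} = R `` {a \<otimes>\<^bsub>M\<^esub> b}" if "x \<in> R `` {a}" "y \<in> R `` {b}" for x y
    using R'[of a x b y] that eq by (auto dest: equiv_class_eq)
  then show ?thesis
    using self unfolding quot_monoid_def monoid.simps
    by (intro UN_constant_eq ballI) blast+
qed

lemma quot_act_class:
  assumes eq: "equiv (carrier M) R"
    and act: "\<And>a b. (a, b) \<in> R \<Longrightarrow> (act n a, act n b) \<in> R" and "a \<in> carrier M"
  shows "quot_act R act n (R `` {a}) = R `` {act n a}"
proof -
  have "a \<in> R `` {a}" using equiv_class_self[OF eq] assms(3) by blast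
  moreover have "R `` {act n x} = R `` {act n a}" if "x \<in> R `` {a}" for x
    using act[of a x] that eq by (auto dest: equiv_class_eq)
  ultimately show ?thesis
    unfolding quot_act_def by (intro UN_constant_eq ballI) blast+
qed

lemma int_monoid_quot:
  assumes M: "int_monoid M act" and R: "monoid_congruence M R"
    and act: "\<And>n a b. (a, b) \<in> R \<Longrightarrow> (act n a, act n b) \<in> R"
  shows "int_monoid (quot_monoid M R) (quot_act R act)"
proof -
  interpret int_monoid M act by fact
  have eq: "equiv (carrier M) R" using R by (simp add: monoid_congruence_def)
  note qm = quot_mult_class[OF R]
  note qa = quot_act_class[where act = act, OF eq act]
  have car: "carrier (quot_monoid M R) = carrier M // R"
    and one: "\<one>\<^bsub>quot_monoid M R\<^esub> = R `` {\<one>\<^bsub>M\<^esub>}"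
    by (simp_all add: quot_monoid_def)
  have ex: "\<exists>a \<in> carrier M. A = R `` {a}" if "A \<in> carrier (quot_monoid M R)" for A
    using that unfolding car by (auto elim: quotientE)
  have cl: "R `` {a} \<in> carrier (quot_monoid M R)" if "a \<in> carrier M" for a
    using that unfolding car by (rule quotientI)
  show ?thesis
  proof
    fix x y assume "x \<in> carrier (quot_monoid M R)" "y \<in> carrier (quot_monoid M R)"
    then obtain a b where ab: "a \<in> carrier M" "x = R `` {a}" "b \<in> carrier M" "y = R `` {b}"
      using ex by metis
    show "x \<otimes>\<^bsub>quot_monoid M R\<^esub> y \<in> carrier (quot_monoid M R)"
      using ab by (simp add: qm cl)
    show "x \<otimes>\<^bsub>quot_monoid M R\<^esub> y = y \<otimes>\<^bsub>quot_monoid M R\<^esub> x"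
      using ab by (simp add: qm m_comm)
    fix n :: int
    show "quot_act R act n (x \<otimes>\<^bsub>quot_monoid M R\<^esub> y)
        = quot_act R act n x \<otimes>\<^bsub>quot_monoid M R\<^esub> quot_act R act n y"
      using ab by (simp add: qm qa act_closed act_mult)
    fix z assume "z \<in> carrier (quot_monoid M R)"
    then obtain c where "c \<in> carrier M" "z = R `` {c}" using ex by metis
    then show "x \<otimes>\<^bsub>quot_monoid M R\<^esub> y \<otimes>\<^bsub>quot_monoid M R\<^esub> z
        = x \<otimes>\<^bsub>quot_monoid M R\<^esub> (y \<otimes>\<^bsub>quot_monoid M R\<^esub> z)"
      using ab by (simp add: qm m_assoc)
  next
    show "\<one>\<^bsub>quot_monoid M R\<^esub> \<in> carrier (quot_monoid M R)"
      by (simp add: one cl)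
  next
    fix x assume "x \<in> carrier (quot_monoid M R)"
    then obtain a where a: "a \<in> carrier M" "x = R `` {a}" using ex by metis
    show "\<one>\<^bsub>quot_monoid M R\<^esub> \<otimes>\<^bsub>quot_monoid M R\<^esub> x = x"
      "x \<otimes>\<^bsub>quot_monoid M R\<^esub> \<one>\<^bsub>quot_monoid M R\<^esub> = x"
      using a by (simp_all add: one qm)
    fix m n :: int
    show "quot_act R act n x \<in> carrier (quot_monoid M R)"
      using a by (simp add: qa cl act_closed)
    show "quot_act R act 0 x = x"
      using a by (simp add: qa act_zero)
    show "quot_act R act (m + n) x = quot_act R act m (quot_act R act n x)"
      using a by (simp add: qa act_closed act_add)
  next
    fix n :: int
    show "quot_act R act n \<one>\<^bsub>quot_monoid M R\<^esub> = \<one>\<^bsub>quot_monoid M R\<^esub>"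
      by (simp add: one qa act_one)
  qed
qed

definition ideal_cong :: "('a, 'm) monoid_scheme \<Rightarrow> 'a set \<Rightarrow> 'a rel" where
  "ideal_cong M I = {(a, b). a \<in> carrier M \<and> b \<in> carrier M \<and>
     (\<exists>i \<in> I. \<exists>j \<in> I. a \<otimes>\<^bsub>M\<^esub> i = b \<otimes>\<^bsub>M\<^esub> j)}"

lemma monoid_congruence_ideal_cong:
  assumes "comm_monoid M" "submonoid I M"
  shows "monoid_congruence M (ideal_cong M I)"
proof -
  interpret comm_monoid M by fact
  interpret I: submonoid I M by fact
  have IM: "x \<in> carrier M" if "x \<in> I" for x using I.subset that by auto
  have "trans (ideal_cong M I)"
  proof (rule transI)
    fix a b c assume "(a, b) \<in> ideal_cong M I" "(b, c) \<in> ideal_cong M I"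
    then obtain i j k l where *: "a \<in> carrier M" "b \<in> carrier M" "c \<in> carrier M"
      "i \<in> I" "j \<in> I" "k \<in> I" "l \<in> I" "a \<otimes>\<^bsub>M\<^esub> i = b \<otimes>\<^bsub>M\<^esub> j" "b \<otimes>\<^bsub>M\<^esub> k = c \<otimes>\<^bsub>M\<^esub> l"
      by (auto simp: ideal_cong_def)
    have "a \<otimes>\<^bsub>M\<^esub> (i \<otimes>\<^bsub>M\<^esub> k) = (a \<otimes>\<^bsub>M\<^esub> i) \<otimes>\<^bsub>M\<^esub> k"
      using *(1-7) by (simp add: IM m_assoc)
    also have "\<dots> = (b \<otimes>\<^bsub>M\<^esub> k) \<otimes>\<^bsub>M\<^esub> j"
      unfolding *(8) using *(1-7) by (simp add: IM m_ac)
    also have "\<dots> = c \<otimes>\<^bsub>M\<^esub> (l \<otimes>\<^bsub>M\<^esub> j)"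
      unfolding *(9) using *(1-7) by (simp add: IM m_assoc)
    finally show "(a, c) \<in> ideal_cong M I"
      using * I.m_closed unfolding ideal_cong_def by blast
  qed
  moreover have "refl_on (carrier M) (ideal_cong M I)"
    using I.one_closed unfolding ideal_cong_def refl_on_def by blast
  moreover have "sym (ideal_cong M I)"
    unfolding sym_def ideal_cong_def by simp metis
  moreover have "ideal_cong M I \<subseteq> carrier M \<times> carrier M"
    by (auto simp: ideal_cong_def)
  ultimately have "equiv (carrier M) (ideal_cong M I)"
    by (simp add: equiv_def)
  moreover have "(a \<otimes>\<^bsub>M\<^esub> c, b \<otimes>\<^bsub>M\<^esub> d) \<in> ideal_cong M I"
    if "(a, b) \<in> ideal_cong M I" "(c, d) \<in> ideal_cong M I" for a b c d
  proof -
    from that obtain i j k l where *: "a \<in> carrier M" "b \<in> carrier M" "c \<in> carrier M"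
      "d \<in> carrier M" "i \<in> I" "j \<in> I" "k \<in> I" "l \<in> I"
      "a \<otimes>\<^bsub>M\<^esub> i = b \<otimes>\<^bsub>M\<^esub> j" "c \<otimes>\<^bsub>M\<^esub> k = d \<otimes>\<^bsub>M\<^esub> l"
      by (auto simp: ideal_cong_def)
    have "(a \<otimes>\<^bsub>M\<^esub> c) \<otimes>\<^bsub>M\<^esub> (i \<otimes>\<^bsub>M\<^esub> k) = (a \<otimes>\<^bsub>M\<^esub> i) \<otimes>\<^bsub>M\<^esub> (c \<otimes>\<^bsub>M\<^esub> k)"
      using *(1-8) by (simp add: IM m_ac)
    also have "\<dots> = (b \<otimes>\<^bsub>M\<^esub> d) \<otimes>\<^bsub>M\<^esub> (j \<otimes>\<^bsub>M\<^esub> l)"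
      unfolding *(9,10) using *(1-8) by (simp add: IM m_ac)
    finally show ?thesis
      using * I.m_closed m_closed unfolding ideal_cong_def by blast
  qed
  ultimately show ?thesis by (simp add: monoid_congruence_def)
qed

lemma int_monoid_ideal_quot:
  assumes M: "int_monoid M act" and I: "order_ideal M act I"
  shows "int_monoid (quot_monoid M (ideal_cong M I)) (quot_act (ideal_cong M I) act)"
proof (rule int_monoid_quot[OF M])
  interpret int_monoid M act by fact
  have sub: "submonoid I M" using I by (simp add: order_ideal_def)
  show "monoid_congruence M (ideal_cong M I)"
    by (rule monoid_congruence_ideal_cong[OF _ sub]) (rule comm_monoid_axioms)
  fix n a b assume "(a, b) \<in> ideal_cong M I"
  then obtain i j where *: "a \<in> carrier M" "b \<in> carrier M" "i \<in> I" "j \<in> I"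
    "a \<otimes>\<^bsub>M\<^esub> i = b \<otimes>\<^bsub>M\<^esub> j" by (auto simp: ideal_cong_def)
  then have "i \<in> carrier M" "j \<in> carrier M" using submonoid.subset[OF sub] by auto
  then have "act n a \<otimes>\<^bsub>M\<^esub> act n i = act n b \<otimes>\<^bsub>M\<^esub> act n j"
    using * by (metis act_mult)
  moreover have "act n i \<in> I" "act n j \<in> I" using I * by (auto simp: order_ideal_def)
  ultimately show "(act n a, act n b) \<in> ideal_cong M I"
    using * unfolding ideal_cong_def by (blast intro: act_closed)
qed

section \<open>Commutative monoids given by generators and relations\<close>

definition free_comm_monoid :: "'g set \<Rightarrow> 'g multiset monoid" where
  "free_comm_monoid S = \<lparr>carrier = {m. set_mset m \<subseteq> S}, mult = (+), one = {#}\<rparr>"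

inductive_set generated_cong :: "('a, 'm) monoid_scheme \<Rightarrow> 'a rel \<Rightarrow> 'a rel"
  for M and R where
  base: "(a, b) \<in> R \<Longrightarrow> a \<in> carrier M \<Longrightarrow> b \<in> carrier M \<Longrightarrow> (a, b) \<in> generated_cong M R"
| refl: "a \<in> carrier M \<Longrightarrow> (a, a) \<in> generated_cong M R"
| sym: "(a, b) \<in> generated_cong M R \<Longrightarrow> (b, a) \<in> generated_cong M R"
| trans: "(a, b) \<in> generated_cong M R \<Longrightarrow> (b, c) \<in> generated_cong M R \<Longrightarrow>
    (a, c) \<in> generated_cong M R"
| mult: "(a, b) \<in> generated_cong M R \<Longrightarrow> (c, d) \<in> generated_cong M R \<Longrightarrow>
    (a \<otimes>\<^bsub>M\<^esub> c, b \<otimes>\<^bsub>M\<^esub> d) \<in> generated_cong M R"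

lemma monoid_congruence_generated_cong:
  assumes "monoid M"
  shows "monoid_congruence M (generated_cong M R)"
proof -
  interpret monoid M by fact
  have "a \<in> carrier M \<and> b \<in> carrier M" if "(a, b) \<in> generated_cong M R" for a b
    using that by induction auto
  then have "generated_cong M R \<subseteq> carrier M \<times> carrier M" by auto
  moreover have "Relation.refl_on (carrier M) (generated_cong M R)"
    by (auto simp: refl_on_def intro: generated_cong.refl)
  moreover have "Relation.sym (generated_cong M R)"
    by (auto simp: sym_def intro: generated_cong.sym)
  moreover have "Relation.trans (generated_cong M R)"
    by (rule transI) (rule generated_cong.trans)
  ultimately show ?thesis
    by (auto simp: monoid_congruence_def equiv_def intro: generated_cong.mult)
qed

section \<open>The talented monoid of a graph\<close>

text \<open>The source map is \<open>tail\<close>, the range map is \<open>head\<close>, and \<open>s\<inverse>(v)\<close> is \<open>out_arcs E v\<close>.\<close>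

locale countable_digraph = wf_digraph E for E :: "('v, 'e) pre_digraph" +
  assumes countable_verts: "countable (verts E)"
    and countable_arcs: "countable (arcs E)"

definition row_finite :: "('v, 'e) pre_digraph \<Rightarrow> bool" where
  "row_finite E \<longleftrightarrow> (\<forall>v \<in> verts E. finite (out_arcs E v))"

definition regular_vertex :: "('v, 'e) pre_digraph \<Rightarrow> 'v \<Rightarrow> bool" where
  "regular_vertex E v \<longleftrightarrow> v \<in> verts E \<and> out_arcs E v \<noteq> {}"

definition talented_generators :: "('v, 'e) pre_digraph \<Rightarrow> ('v \<times> int) set" where
  "talented_generators E = verts E \<times> UNIV"

text \<open>
  The pair \<open>(v, i)\<close> stands for \<open>v(i)\<close>. Only meaningful for row-finite graphs: \<open>mset_set\<close> of an
  infinite set is empty.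
\<close>
definition talented_relations :: "('v, 'e) pre_digraph \<Rightarrow> ('v \<times> int) multiset rel" where
  "talented_relations E =
     {({#(v, i)#}, {#(head E e, i + 1). e \<in># mset_set (out_arcs E v)#}) | v i. regular_vertex E v}"

definition talented_cong :: "('v, 'e) pre_digraph \<Rightarrow> ('v \<times> int) multiset rel" where
  "talented_cong E =
     generated_cong (free_comm_monoid (talented_generators E)) (talented_relations E)"

definition talented_monoid :: "('v, 'e) pre_digraph \<Rightarrow> ('v \<times> int) multiset set monoid" where
  "talented_monoid E = quot_monoid (free_comm_monoid (talented_generators E)) (talented_cong E)"

definition shift :: "int \<Rightarrow> ('v \<times> int) multiset \<Rightarrow> ('v \<times> int) multiset" where
  "shift n m = {#(v, i + n). (v, i) \<in># m#}"

definition talented_act ::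
  "('v, 'e) pre_digraph \<Rightarrow> int \<Rightarrow> ('v \<times> int) multiset set \<Rightarrow> ('v \<times> int) multiset set" where
  "talented_act E = quot_act (talented_cong E) shift"

lemma int_monoid_free: "int_monoid (free_comm_monoid (talented_generators E)) shift"
  by unfold_locales
    (auto simp: free_comm_monoid_def talented_generators_def shift_def ac_simps
       multiset.map_comp comp_def case_prod_unfold)

lemma talented_cong_shift:
  assumes "(a, b) \<in> talented_cong E"
  shows "(shift n a, shift n b) \<in> talented_cong E"
  using assms unfolding talented_cong_def
proof induction
  case (base a b)
  interpret F: int_monoid "free_comm_monoid (talented_generators E)" shift
    by (rule int_monoid_free)
  from base obtain v i where "regular_vertex E v" "a = {#(v, i)#}"
    "b = {#(head E e, i + 1). e \<in># mset_set (out_arcs E v)#}"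
    by (auto simp: talented_relations_def)
  then have "shift n a = {#(v, i + n)#} \<and> regular_vertex E v \<and>
    shift n b = {#(head E e, (i + n) + 1). e \<in># mset_set (out_arcs E v)#}"
    by (simp add: shift_def multiset.map_comp comp_def ac_simps)
  then have "(shift n a, shift n b) \<in> talented_relations E"
    unfolding talented_relations_def by blast
  then show ?case
    using base by (intro generated_cong.base F.act_closed)
next
  case (refl a)
  interpret F: int_monoid "free_comm_monoid (talented_generators E)" shift
    by (rule int_monoid_free)
  show ?case using refl by (intro generated_cong.refl F.act_closed)
next
  case (mult a b c d)
  then show ?case
    using generated_cong.mult[OF mult.IH]
    by (simp add: free_comm_monoid_def shift_def)
qed (auto intro: generated_cong.sym generated_cong.trans)

lemma int_monoid_talented: "int_monoid (talented_monoid E) (talented_act E)"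
  unfolding talented_monoid_def talented_act_def
proof (rule int_monoid_quot[OF int_monoid_free])
  interpret F: int_monoid "free_comm_monoid (talented_generators E)" shift
    by (rule int_monoid_free)
  show "monoid_congruence (free_comm_monoid (talented_generators E)) (talented_cong E)"
    unfolding talented_cong_def
    by (rule monoid_congruence_generated_cong) (rule F.monoid_axioms)
qed (rule talented_cong_shift)

end

theory Submission
  imports Defs
begin

text \<open>
  Let \<open>H\<close> be the set of vertices \<open>v\<close> with \<open>v(i) \<in> I\<close>. It is hereditary and saturated, so that
  deleting \<open>H\<close> from \<open>E\<close> leaves a graph in which every remaining vertex that emitted an edge in \<open>E\<close>
  still emits one; this residual graph presents \<open>T\<^sub>E/I\<close>. Suppose that \<open>\<int>\<close> does not act freely on
  \<open>T\<^sub>E/I\<close>. Three observations lead to a contradiction.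

  \<^item> An equality of classes becomes an equality of multisets once all generators are rewritten, by
  the defining relations of the residual graph, up to one high enough level
  (\<open>unfold_to_outside_cong\<close>). Hence a nonzero periodic element of \<open>T\<^sub>E/I\<close> gives a multiset of
  generators that, after \<open>m > 0\<close> rounds of rewriting, has merely been shifted by \<open>m\<close>. Rewriting never
  makes a multiset smaller and shifting keeps the size, so no round ever splits a vertex in two. The
  vertices that occur form a finite nonempty set \<open>D\<close> on which every vertex has exactly one
  successor in the residual graph, again in \<open>D\<close> (\<open>finite_exitless_set\<close>).

  \<^item> Every \<open>z \<in> D\<close> leads to a cycle in \<open>D\<close>. Running once around it from a vertex \<open>c\<close> gives
  \<open>c(i) = c(i + p) + h\<close> in \<open>T\<^sub>E\<close>, where \<open>p > 0\<close> and \<open>h \<in> I\<close> collects the exits into \<open>H\<close>. As the action on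
  \<open>T\<^sub>E\<close> is free, \<open>h \<noteq> 0\<close>. So every \<open>z(t)\<close> with \<open>z \<in> D\<close> lies above a nonzero element of \<open>I\<close>
  (\<open>exitless_above_ideal\<close>).

  \<^item> Let \<open>v \<in> D\<close> and \<open>0 \<noteq> b \<in> I\<^sup>\<bottom>\<close>. If \<open>v(0) \<le> b\<close>, then \<open>b\<close> lies above a nonzero element of \<open>I\<close>,
  which is impossible. If \<open>b \<le> v(0)\<close>, then rewriting \<open>b\<close> in the residual graph up to a high level
  yields only generators \<open>z(t)\<close> with \<open>z \<in> D\<close>, and at least one of them because \<open>b \<notin> I\<close>;
  it lies below \<open>b\<close> and above a nonzero element of \<open>I\<close>, again impossible. So \<open>v(0) \<in> I\<^sup>\<bottom>\<^sup>\<bottom> = I\<close> (\<open>exitless_in_perp_perp\<close>), although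
  \<open>v \<notin> H\<close>.
\<close>

section \<open>Unfolding multisets of levelled vertices\<close>

text \<open>
  Unfolding replaces \<open>v(i)\<close> by \<open>\<Sum>w(i + 1)\<close> over the successors \<open>w\<close> of \<open>v\<close>, counted with multiplicity.
  The successor function is a parameter since it is the residual graph, with \<open>H\<close> deleted, that
  gets unfolded. A vertex without successors is a sink and stays where it is.
\<close>
definition unfold_step :: "('v \<Rightarrow> 'v multiset) \<Rightarrow> ('v \<times> int) multiset \<Rightarrow> ('v \<times> int) multiset" where
  "unfold_step succ x = (\<Sum>(v, i)\<in>#x. if succ v = {#} then {#(v, i)#} else {#(w, i + 1). w \<in># succ v#})"

definition unfold_to ::
  "('v \<Rightarrow> 'v multiset) \<Rightarrow> int \<Rightarrow> ('v \<times> int) multiset \<Rightarrow> ('v \<times> int) multiset" where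
  "unfold_to succ L x = (\<Sum>(v, i)\<in>#x. (unfold_step succ ^^ nat (L - i)) {#(v, i)#})"

lemma unfold_step_empty [simp]: "unfold_step succ {#} = {#}"
  by (simp add: unfold_step_def)

lemma unfold_step_union: "unfold_step succ (x + y) = unfold_step succ x + unfold_step succ y"
  by (simp add: unfold_step_def)

lemma unfold_steps_empty [simp]: "(unfold_step succ ^^ k) {#} = {#}"
  by (induction k) auto

lemma unfold_steps_union:
  "(unfold_step succ ^^ k) (x + y) = (unfold_step succ ^^ k) x + (unfold_step succ ^^ k) y"
  by (induction k) (auto simp: unfold_step_union)

lemma unfold_to_empty [simp]: "unfold_to succ L {#} = {#}"
  by (simp add: unfold_to_def)

lemma unfold_to_union: "unfold_to succ L (x + y) = unfold_to succ L x + unfold_to succ L y"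
  by (simp add: unfold_to_def)

lemma unfold_to_single:
  "unfold_to succ L {#(v, i)#} = (unfold_step succ ^^ nat (L - i)) {#(v, i)#}"
  by (simp add: unfold_to_def)

lemma shift_empty [simp]: "shift n {#} = {#}"
  by (simp add: shift_def)

lemma shift_union: "shift n (x + y) = shift n x + shift n y"
  by (simp add: shift_def)

lemma shift_single [simp]: "shift n {#(v, i)#} = {#(v, i + n)#}"
  by (simp add: shift_def)

lemma shift_shift: "shift m (shift n x) = shift (m + n) x"
  by (simp add: shift_def multiset.map_comp comp_def case_prod_unfold ac_simps)

lemma shift_zero [simp]: "shift 0 x = x"
  by (simp add: shift_def)

lemma in_shift_iff: "(v, i) \<in># shift n x \<longleftrightarrow> (v, i - n) \<in># x"
  by (force simp: shift_def)

lemma shift_vertices: "fst ` set_mset (shift n x) = fst ` set_mset x"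
  by (auto simp: shift_def image_image case_prod_unfold)

lemma size_shift [simp]: "size (shift n x) = size x"
  by (simp add: shift_def)

lemma unfold_step_shift: "unfold_step succ (shift n x) = shift n (unfold_step succ x)"
proof (induction x)
  case (add p x)
  obtain v i where p: "p = (v, i)" by fastforce
  have "unfold_step succ (shift n {#p#}) = shift n (unfold_step succ {#p#})"
    by (simp add: p unfold_step_def shift_def multiset.map_comp comp_def ac_simps)
  with add show ?case
    using unfold_step_union[of succ "shift n {#p#}" "shift n x"] unfold_step_union[of succ "{#p#}" x]
    by (metis add_mset_add_single add.commute shift_union)
qed simp

lemma unfold_steps_shift:
  "(unfold_step succ ^^ k) (shift n x) = shift n ((unfold_step succ ^^ k) x)"
  by (induction k) (auto simp: unfold_step_shift)

lemma unfold_to_shift: "unfold_to succ L (shift n x) = shift n (unfold_to succ (L - n) x)"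
proof (induction x)
  case (add p x)
  obtain v i where p: "p = (v, i)" by fastforce
  have "unfold_to succ L (shift n {#p#}) = shift n (unfold_to succ (L - n) {#p#})"
    using unfold_steps_shift[of "nat (L - n - i)" succ n "{#(v, i)#}"]
    by (simp add: p unfold_to_single algebra_simps)
  with add show ?case
    by (metis add_mset_add_single add.commute shift_union unfold_to_union)
qed simp

text \<open>
  The level bound makes \<open>nat\<close> exact. After unfolding to level \<open>L\<close> all generators other than sinks then
  sit on the level \<open>L\<close>, so that unfolding further proceeds in lockstep.
\<close>
lemma unfold_to_add:
  assumes "\<And>v i. (v, i) \<in># x \<Longrightarrow> i \<le> L"
  shows "unfold_to succ (L + int k) x = (unfold_step succ ^^ k) (unfold_to succ L x)"
  using assms
proof (induction x)
  case (add p x)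
  obtain v i where p: "p = (v, i)" by fastforce
  have "nat (L + int k - i) = k + nat (L - i)" using add.prems[of v i] p by auto
  then have "unfold_to succ (L + int k) {#p#} = (unfold_step succ ^^ k) (unfold_to succ L {#p#})"
    by (simp add: p unfold_to_single funpow_add)
  with add show ?case
    by (metis add_mset_add_single unfold_steps_union unfold_to_union union_iff)
qed simp

text \<open>
  Unfolding to a fixed level does not see the defining relation \<open>v(i) = \<Sum>w(i + 1)\<close>. Counting steps
  instead of levels would not give this, as the two sides are one step apart.
\<close>
lemma unfold_to_successors:
  assumes "succ v \<noteq> {#}" "i < L"
  shows "unfold_to succ L {#(v, i)#} = unfold_to succ L {#(w, i + 1). w \<in># succ v#}"
proof -
  have *: "(unfold_step succ ^^ nat (L - (i + 1))) {#(w, i + 1). w \<in># y#}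
      = unfold_to succ L {#(w, i + 1). w \<in># y#}" for y
  proof (induction y)
    case (add w y)
    then show ?case
      using unfold_steps_union[of "nat (L - (i + 1))" succ "{#(w, i + 1)#}" "{#(w, i + 1). w \<in># y#}"]
        unfold_to_union[of succ L "{#(w, i + 1)#}" "{#(w, i + 1). w \<in># y#}"]
      by (simp add: unfold_to_single)
  qed simp
  have "nat (L - i) = Suc (nat (L - (i + 1)))" using assms(2) by simp
  then have "unfold_to succ L {#(v, i)#}
      = (unfold_step succ ^^ nat (L - (i + 1))) (unfold_step succ {#(v, i)#})"
    by (simp only: unfold_to_single funpow_Suc_right comp_apply)
  then show ?thesis
    using assms(1) by (simp add: unfold_step_def *[simplified])
qed

lemma in_unfold_stepE:
  assumes "(z, t) \<in># unfold_step succ x"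
  obtains "(z, t) \<in># x" "succ z = {#}"
  | v where "(v, t - 1) \<in># x" "z \<in># succ v"
  using assms by (fastforce simp: unfold_step_def split: if_splits)

lemma unfold_step_vertices:
  assumes "fst ` set_mset x \<subseteq> D" "\<forall>v\<in>D. set_mset (succ v) \<subseteq> D"
  shows "fst ` set_mset (unfold_step succ x) \<subseteq> D"
  using assms by (fastforce elim!: in_unfold_stepE)

lemma unfold_steps_vertices:
  assumes "fst ` set_mset x \<subseteq> D" "\<forall>v\<in>D. set_mset (succ v) \<subseteq> D"
  shows "fst ` set_mset ((unfold_step succ ^^ k) x) \<subseteq> D"
proof (induction k)
  case (Suc k)
  then show ?case
    using unfold_step_vertices[OF _ assms(2)] by simp
qed (use assms(1) in simp)

lemma unfold_to_vertices:
  assumes "fst ` set_mset x \<subseteq> D" "\<forall>v\<in>D. set_mset (succ v) \<subseteq> D"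
  shows "fst ` set_mset (unfold_to succ L x) \<subseteq> D"
  using assms(1)
proof (induction x)
  case (add p x)
  obtain v i where p: "p = (v, i)" by fastforce
  have "fst ` set_mset (unfold_to succ L {#p#}) \<subseteq> D"
    unfolding p unfold_to_single using add.prems assms(2) p
    by (intro unfold_steps_vertices) auto
  with add show ?case
    using unfold_to_union[of succ L "{#p#}" x] by auto
qed simp

lemma size_unfold_step_single: "1 \<le> size (unfold_step succ {#p#})"
  by (cases p) (auto simp: unfold_step_def Suc_le_eq nonempty_has_size[symmetric])

lemma size_unfold_step: "size x \<le> size (unfold_step succ x)"
proof (induction x)
  case (add p x)
  then show ?case
    using unfold_step_union[of succ "{#p#}" x] size_unfold_step_single[of succ p] by simp
qed simp

lemma size_unfold_steps: "size x \<le> size ((unfold_step succ ^^ k) x)"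
  by (induction k) (auto intro: order_trans size_unfold_step)

lemma unfold_to_nonempty:
  assumes "x \<noteq> {#}"
  shows "unfold_to succ L x \<noteq> {#}"
proof -
  obtain p y where x: "x = add_mset p y" using assms by (meson multiset_cases)
  obtain v i where p: "p = (v, i)" by fastforce
  have "unfold_to succ L {#p#} \<noteq> {#}"
    using size_unfold_steps[of "{#p#}" "nat (L - i)" succ] p unfold_to_single[of succ L v i]
    by (metis not_one_le_zero size_empty size_single)
  then show ?thesis
    using unfold_to_union[of succ L "{#p#}" y] x by simp
qed

text \<open>
  No element of a multiset disappears in a step, so a step that keeps the total size replaces each
  element by exactly one.
\<close>
lemma size_unfold_step_eqD:
  assumes "size (unfold_step succ x) = size x" "(v, i) \<in># x" "succ v \<noteq> {#}"
  obtains w where "succ v = {#w#}" "(w, i + 1) \<in># unfold_step succ x"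
proof -
  obtain y where x: "x = add_mset (v, i) y" using assms(2) by (meson multi_member_split)
  have *: "unfold_step succ x = unfold_step succ {#(v, i)#} + unfold_step succ y"
    using unfold_step_union[of succ "{#(v, i)#}" y] x by simp
  then have "size (unfold_step succ {#(v, i)#}) = 1"
    using assms(1) size_unfold_step[of y succ] size_unfold_step_single[of succ "(v, i)"] x by simp
  then have "size (succ v) = 1" using assms(3) by (simp add: unfold_step_def)
  then obtain w where "succ v = {#w#}" by (metis One_nat_def size_1_singleton_mset)
  then show thesis
  proof (rule that)
    show "(w, i + 1) \<in># unfold_step succ x"
      unfolding * using \<open>succ v = {#w#}\<close> by (simp add: unfold_step_def)
  qed
qed

text \<open>
  A multiset that reproduces itself up to a shift: its size cannot grow under unfolding, so no
  element ever branches. Sinks do not occur, since a sink keeps its level while the shift moves it,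
  which would put infinitely many copies of it, at different levels, in one finite multiset.
\<close>
lemma finite_exitless_set:
  assumes y: "y \<noteq> {#}" and m: "0 < m" and per: "(unfold_step succ ^^ m) y = shift (int m) y"
    and P: "fst ` set_mset y \<subseteq> P" "\<forall>v\<in>P. set_mset (succ v) \<subseteq> P"
  obtains D where "finite D" "D \<noteq> {}" "D \<subseteq> P" "\<forall>z\<in>D. \<exists>w\<in>D. succ z = {#w#}"
proof -
  define Y where "Y k = (unfold_step succ ^^ k) y" for k
  have Y0: "Y 0 = y" and YSuc: "Y (Suc k) = unfold_step succ (Y k)" for k
    by (simp_all add: Y_def)
  have Yper: "Y (k + m) = shift (int m) (Y k)" for k
    by (simp add: Y_def funpow_add per unfold_steps_shift)
  have Yper': "Y (k + j * m) = shift (int (j * m)) (Y k)" for j k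
  proof (induction j)
    case (Suc j)
    have "Y (k + Suc j * m) = Y ((k + j * m) + m)" by (simp add: ac_simps)
    then show ?case by (simp only: Yper Suc shift_shift) (simp add: algebra_simps)
  qed simp
  have size_le: "size (Y k) \<le> size (Y (k + j))" for k j
    by (induction j) (auto simp: YSuc intro: order_trans size_unfold_step)
  have size_eq: "size (unfold_step succ (Y k)) = size (Y k)" for k
    using size_le[of k 1] size_le[of "Suc k" "m - 1"] m Yper[of k] by (simp add: YSuc)
  have nosink: "succ z \<noteq> {#}" if "(z, t) \<in># Y k" for z t k
  proof
    assume z: "succ z = {#}"
    \<comment> \<open>A sink survives every step unchanged.\<close>
    have "(z, t) \<in># Y (k + j)" for j
    proof (induction j)
      case (Suc j)
      then obtain x where "Y (k + j) = add_mset (z, t) x" by (meson multi_member_split)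
      then show ?case using z by (simp add: YSuc unfold_step_def)
    qed (use that in simp)
    then have "(z, t) \<in># shift (int (j * m)) (Y k)" for j
      by (simp only: Yper'[symmetric])
    then have "(z, t - int (j * m)) \<in># Y k" for j
      by (simp only: in_shift_iff)
    then have "range (\<lambda>j. (z, t - int (j * m))) \<subseteq> set_mset (Y k)" by blast
    then have "finite (range (\<lambda>j. (z, t - int (j * m))))"
      using finite_subset by blast
    moreover have "inj (\<lambda>j. (z, t - int (j * m)))" using m by (auto simp: inj_def)
    ultimately show False using range_inj_infinite by blast
  qed
  define D where "D = (\<Union>k. fst ` set_mset (Y k))"
  have "fst ` set_mset (Y k) = fst ` set_mset (Y (k mod m))" for k
    using Yper'[of "k mod m" "k div m"] by (simp add: shift_vertices)
  \<comment> \<open>Shifting keeps the vertices, so only \<open>m\<close> of the multisets contribute to \<open>D\<close>.\<close>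
  moreover have "k mod m < m" for k using m by simp
  ultimately have "D = (\<Union>k<m. fst ` set_mset (Y k))"
    unfolding D_def by fast
  then have fin: "finite D" by simp
  have ne: "D \<noteq> {}" using y Y0 unfolding D_def by auto
  have sub: "D \<subseteq> P"
    unfolding D_def Y_def using unfold_steps_vertices[OF P] by (intro UN_least)
  have "\<forall>z\<in>D. \<exists>w\<in>D. succ z = {#w#}"
  proof
    fix z assume "z \<in> D"
    obtain k t where zt: "(z, t) \<in># Y k" using \<open>z \<in> D\<close> by (auto simp: D_def)
    obtain w where "succ z = {#w#}" "(w, t + 1) \<in># unfold_step succ (Y k)"
      by (rule size_unfold_step_eqD[OF size_eq zt nosink[OF zt]])
    then have "succ z = {#w#}" "(w, t + 1) \<in># Y (Suc k)" by (simp_all add: YSuc)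
    moreover from this(2) have "w \<in> D" unfolding D_def by (metis UN_I UNIV_I fst_conv imageI)
    ultimately show "\<exists>w\<in>D. succ z = {#w#}" by blast
  qed
  with fin ne sub show thesis by (rule that)
qed

text \<open>
  Invariance under a shift by \<open>n\<close>, up to unfolding, is self-reproduction after \<open>\<bar>n\<bar>\<close> steps. Both signs
  of \<open>n\<close> reduce to the same equation because unfolding to level \<open>L\<close> after a shift by \<open>n\<close> is
  unfolding to level \<open>L - n\<close> before it.
\<close>
lemma finite_exitless_set_of_periodic:
  assumes x: "x \<noteq> {#}" and n: "n \<noteq> 0"
    and per: "\<And>L. K \<le> L \<Longrightarrow> unfold_to succ L (shift n x) = unfold_to succ L x"
    and P: "fst ` set_mset x \<subseteq> P" "\<forall>v\<in>P. set_mset (succ v) \<subseteq> P"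
  obtains D where "finite D" "D \<noteq> {}" "D \<subseteq> P" "\<forall>z\<in>D. \<exists>w\<in>D. succ z = {#w#}"
proof -
  \<comment> \<open>High enough for the periodicity to hold at the levels \<open>L\<close> and \<open>L + n\<close>, and above all of \<open>x\<close>.\<close>
  define L where "L = Max (insert (\<bar>K\<bar> + \<bar>n\<bar>) (snd ` set_mset x))"
  have L: "\<bar>K\<bar> + \<bar>n\<bar> \<le> L" "\<And>v i. (v, i) \<in># x \<Longrightarrow> i \<le> L"
  proof -
    have *: "j \<le> L" if "j \<in> insert (\<bar>K\<bar> + \<bar>n\<bar>) (snd ` set_mset x)" for j
      unfolding L_def using that by (intro Max_ge) auto
    show "\<bar>K\<bar> + \<bar>n\<bar> \<le> L" by (rule *) simp
    show "i \<le> L" if "(v, i) \<in># x" for v i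
      using that by (intro *) (auto simp: image_iff intro!: bexI[of _ "(v, i)"])
  qed
  define m where "m = nat \<bar>n\<bar>"
  have "unfold_to succ (L + int m) x = shift (int m) (unfold_to succ L x)"
  proof (cases "0 < n")
    case True
    then show ?thesis
      using per[of "L + n"] L(1) by (simp add: m_def unfold_to_shift)
  next
    case False
    then have "shift (int m) (unfold_to succ L x) = shift (int m) (shift n (unfold_to succ (L - n) x))"
      using per[of L] L(1) by (simp add: unfold_to_shift)
    then show ?thesis using False by (simp add: shift_shift m_def)
  qed
  then have unfold_steps: "(unfold_step succ ^^ m) (unfold_to succ L x) = shift (int m) (unfold_to succ L x)"
    using unfold_to_add[of x L succ m] L(2) by simp
  moreover have "0 < m" using n by (simp add: m_def)
  moreover have "fst ` set_mset (unfold_to succ L x) \<subseteq> P"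
    using P by (rule unfold_to_vertices)
  ultimately obtain D where "finite D" "D \<noteq> {}" "D \<subseteq> P" "\<forall>z\<in>D. \<exists>w\<in>D. succ z = {#w#}"
    using unfold_steps P(2) by (elim finite_exitless_set[OF unfold_to_nonempty[OF x, of succ L]])
  then show thesis by (rule that)
qed


section \<open>Unfolding modulo an order ideal of the talented monoid\<close>

definition out_neighbours :: "('v, 'e) pre_digraph \<Rightarrow> 'v \<Rightarrow> 'v multiset" where
  "out_neighbours E v = {#head E e. e \<in># mset_set (out_arcs E v)#}"

abbreviation over :: "'v set \<Rightarrow> ('v \<times> int) multiset \<Rightarrow> bool" where
  "over S x \<equiv> fst ` set_mset x \<subseteq> S"

locale talented_ideal = countable_digraph E for E :: "('v, 'e) pre_digraph" +
  fixes I :: "('v \<times> int) multiset set set"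
  assumes row_finite: "row_finite E"
    and order_ideal: "order_ideal (talented_monoid E) (talented_act E) I"
begin

abbreviation T :: "('v \<times> int) multiset set monoid" where "T \<equiv> talented_monoid E"

abbreviation cls :: "('v \<times> int) multiset \<Rightarrow> ('v \<times> int) multiset set" where
  "cls x \<equiv> talented_cong E `` {x}"

sublocale T: int_monoid T "talented_act E"
  by (rule int_monoid_talented)

sublocale I: submonoid I T
  using order_ideal by (simp add: order_ideal_def)

lemma ideal_act: "a \<in> I \<Longrightarrow> talented_act E n a \<in> I"
  using order_ideal unfolding order_ideal_def by blast

lemma ideal_divides: "b \<in> I \<Longrightarrow> a \<in> carrier T \<Longrightarrow> a divides\<^bsub>T\<^esub> b \<Longrightarrow> a \<in> I"
  using order_ideal unfolding order_ideal_def by blast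

lemma ideal_carrier: "a \<in> I \<Longrightarrow> a \<in> carrier T"
  using I.subset by blast

lemma ideal_cong_act:
  assumes "(a, b) \<in> ideal_cong T I"
  shows "(talented_act E n a, talented_act E n b) \<in> ideal_cong T I"
proof -
  obtain i j where *: "a \<in> carrier T" "b \<in> carrier T" "i \<in> I" "j \<in> I"
    "a \<otimes>\<^bsub>T\<^esub> i = b \<otimes>\<^bsub>T\<^esub> j" using assms by (auto simp: ideal_cong_def)
  have "talented_act E n a \<otimes>\<^bsub>T\<^esub> talented_act E n i = talented_act E n b \<otimes>\<^bsub>T\<^esub> talented_act E n j"
    using * ideal_carrier by (metis T.act_mult)
  then show ?thesis
    using * ideal_act T.act_closed unfolding ideal_cong_def by blast
qed

lemma over_free: "over (verts E) x \<longleftrightarrow> x \<in> carrier (free_comm_monoid (talented_generators E))"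
  by (auto simp: free_comm_monoid_def talented_generators_def)

lemma monoid_congruence_talented:
  "monoid_congruence (free_comm_monoid (talented_generators E)) (talented_cong E)"
  unfolding talented_cong_def
  using comm_monoid.axioms(1)[OF int_monoid.axioms(1)[OF int_monoid_free]]
  by (rule monoid_congruence_generated_cong)

lemma equiv_talented: "equiv {x. over (verts E) x} (talented_cong E)"
  using monoid_congruence_talented by (simp add: monoid_congruence_def over_free)

lemma cls_closed: "over (verts E) x \<Longrightarrow> cls x \<in> carrier T"
  by (simp add: over_free talented_monoid_def quot_monoid_def quotientI)

lemma carrier_cls:
  assumes "a \<in> carrier T"
  obtains x where "over (verts E) x" "a = cls x"
  using assms that unfolding talented_monoid_def quot_monoid_def over_free
  by (auto elim: quotientE)

lemma cls_union:
  "over (verts E) x \<Longrightarrow> over (verts E) y \<Longrightarrow> cls (x + y) = cls x \<otimes>\<^bsub>T\<^esub> cls y"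
  using quot_mult_class[OF monoid_congruence_talented, of x y]
  by (simp add: over_free[symmetric] talented_monoid_def) (simp add: free_comm_monoid_def)

lemma cls_empty: "cls {#} = \<one>\<^bsub>T\<^esub>"
  by (simp add: talented_monoid_def quot_monoid_def free_comm_monoid_def)

lemma cls_shift: "over (verts E) x \<Longrightarrow> cls (shift n x) = talented_act E n (cls x)"
  using quot_act_class[where act = shift, OF _ talented_cong_shift] monoid_congruence_talented
  unfolding talented_act_def monoid_congruence_def over_free by metis

lemma over_shift: "over S (shift n x) \<longleftrightarrow> over S x"
  by (simp add: shift_vertices)

lemma cls_eqD:
  "cls x = cls y \<Longrightarrow> over (verts E) x \<Longrightarrow> over (verts E) y \<Longrightarrow> (x, y) \<in> talented_cong E"
  using eq_equiv_class[OF _ equiv_talented] by blast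

lemma cls_eqI: "(x, y) \<in> talented_cong E \<Longrightarrow> cls x = cls y"
  by (rule equiv_class_eq[OF equiv_talented])

text \<open>
  Row-finiteness enters here: \<open>mset_set\<close> of an infinite set is empty, and an infinite emitter would
  be taken for a sink.
\<close>
lemma regular_vertex_iff: "v \<in> verts E \<Longrightarrow> regular_vertex E v \<longleftrightarrow> out_neighbours E v \<noteq> {#}"
  using row_finite
  by (auto simp: regular_vertex_def out_neighbours_def row_finite_def mset_set_empty_iff)

lemma out_neighbours_verts: "set_mset (out_neighbours E v) \<subseteq> verts E"
  by (cases "finite (out_arcs E v)") (auto simp: out_neighbours_def)

lemma over_image_Pair: "over S {#(w, i). w \<in># y#} \<longleftrightarrow> set_mset y \<subseteq> S"
  by (auto simp: image_image)

lemma talented_relation: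
  assumes "v \<in> verts E" "out_neighbours E v \<noteq> {#}"
  shows "cls {#(v, i)#} = cls {#(w, i + 1). w \<in># out_neighbours E v#}"
proof (rule cls_eqI)
  have "({#(v, i)#}, {#(w, i + 1). w \<in># out_neighbours E v#}) \<in> talented_relations E"
    using assms regular_vertex_iff
    by (auto simp: talented_relations_def out_neighbours_def multiset.map_comp comp_def)
  then show "({#(v, i)#}, {#(w, i + 1). w \<in># out_neighbours E v#}) \<in> talented_cong E"
    unfolding talented_cong_def using assms(1) out_neighbours_verts[of v]
    by (intro generated_cong.base) (simp_all add: over_free[symmetric] image_image)
qed

text \<open>
  The ideal \<open>I\<close> is generated by a hereditary and saturated set of vertices. Level \<open>0\<close> may stand for
  any level, because \<open>I\<close> is closed under the action.
\<close>
definition H :: "'v set" where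
  "H = {v \<in> verts E. cls {#(v, 0)#} \<in> I}"

abbreviation outside :: "('v \<times> int) multiset \<Rightarrow> ('v \<times> int) multiset" where
  "outside x \<equiv> filter_mset (\<lambda>p. fst p \<notin> H) x"

definition residual_succ :: "'v \<Rightarrow> 'v multiset" where
  "residual_succ v = filter_mset (\<lambda>w. w \<notin> H) (out_neighbours E v)"

lemma H_verts: "H \<subseteq> verts E"
  by (auto simp: H_def)

lemma cls_vertex_in_ideal:
  assumes "v \<in> verts E"
  shows "cls {#(v, i)#} \<in> I \<longleftrightarrow> v \<in> H"
proof -
  have *: "cls {#(v, j)#} \<in> I" if "cls {#(v, k)#} \<in> I" for j k
    using ideal_act[OF that, of "j - k"] cls_shift[of "{#(v, k)#}" "j - k"] assms by simp
  show ?thesis using * assms by (auto simp: H_def)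
qed

text \<open>
  A submonoid that is closed under divisors contains a product exactly if it contains the factors.
\<close>
lemma cls_in_ideal:
  assumes "over (verts E) x"
  shows "cls x \<in> I \<longleftrightarrow> over H x"
  using assms
proof (induction x)
  case empty
  then show ?case by (simp add: cls_empty)
next
  case (add p x)
  obtain v i where p: "p = (v, i)" by fastforce
  have eq: "cls (add_mset p x) = cls {#(v, i)#} \<otimes>\<^bsub>T\<^esub> cls x"
    using cls_union[of "{#(v, i)#}" x] add.prems by (simp add: p)
  have car: "cls {#(v, i)#} \<in> carrier T" "cls x \<in> carrier T"
    using cls_closed[of "{#(v, i)#}"] cls_closed[of x] add.prems by (auto simp: p)
  have "cls {#(v, i)#} \<otimes>\<^bsub>T\<^esub> cls x \<in> I \<longleftrightarrow> cls {#(v, i)#} \<in> I \<and> cls x \<in> I"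
    using car I.m_closed ideal_divides T.m_comm
    by (metis dividesI)
  then show ?case
    unfolding eq using add cls_vertex_in_ideal[of v i] by (simp add: p)
qed

lemma H_hereditary:
  assumes "v \<in> H"
  shows "set_mset (out_neighbours E v) \<subseteq> H"
proof (cases "out_neighbours E v = {#}")
  case False
  have v: "v \<in> verts E" using assms H_verts by blast
  have "cls {#(w, 0 + 1). w \<in># out_neighbours E v#} \<in> I"
    using cls_vertex_in_ideal[OF v, of 0] assms talented_relation[OF v False, of 0] by simp
  then show ?thesis
    using cls_in_ideal[of "{#(w, 0 + 1). w \<in># out_neighbours E v#}"] out_neighbours_verts[of v]
    by (simp only: over_image_Pair)
qed simp

lemma H_saturated:
  assumes "v \<in> verts E" "out_neighbours E v \<noteq> {#}" "set_mset (out_neighbours E v) \<subseteq> H"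
  shows "v \<in> H"
proof -
  have "cls {#(w, 0 + 1). w \<in># out_neighbours E v#} \<in> I"
    using cls_in_ideal[of "{#(w, 0 + 1). w \<in># out_neighbours E v#}"] out_neighbours_verts[of v]
      assms(3) by (simp only: over_image_Pair)
  then show ?thesis
    using cls_vertex_in_ideal[OF assms(1), of 0] talented_relation[OF assms(1,2), of 0] by simp
qed

text \<open>
  Saturation says that deleting \<open>H\<close> turns no vertex into a new sink. This is what makes the unfolding
  in the residual graph respect the relations of \<open>T\<^sub>E\<close>.
\<close>
lemma residual_succ_empty_iff:
  assumes "v \<in> verts E - H"
  shows "residual_succ v = {#} \<longleftrightarrow> out_neighbours E v = {#}"
  using assms H_saturated[of v] by (auto simp: residual_succ_def)

lemma residual_succ_closed: "\<forall>v\<in>verts E - H. set_mset (residual_succ v) \<subseteq> verts E - H"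
  using out_neighbours_verts by (auto simp: residual_succ_def)

lemma over_outside: "over (verts E) x \<Longrightarrow> over (verts E - H) (outside x)"
  by auto

text \<open>
  Unfolding to a high level solves the word problem modulo \<open>I\<close>: generators in \<open>H\<close> are discarded, and
  a relation \<open>v(i) = \<Sum>w(i + 1)\<close> is invisible at all levels above \<open>i\<close>. A level that works for one
  relation may not work for another, hence the quantification over all large levels, which passes
  through transitivity and sums.
\<close>
lemma unfold_to_outside_cong:
  assumes "(x, y) \<in> talented_cong E"
  shows "\<exists>K. \<forall>L\<ge>K. unfold_to residual_succ L (outside x) = unfold_to residual_succ L (outside y)"
  using assms unfolding talented_cong_def
proof induction
  case (base x y)
  then obtain v i where v: "regular_vertex E v" "x = {#(v, i)#}"
    and y: "y = {#(w, i + 1). w \<in># out_neighbours E v#}"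
    by (auto simp: talented_relations_def out_neighbours_def multiset.map_comp comp_def)
  then have vE: "v \<in> verts E" and ne: "out_neighbours E v \<noteq> {#}"
    using regular_vertex_iff by (auto simp: regular_vertex_def)
  have out: "outside y = {#(w, i + 1). w \<in># residual_succ v#}"
    by (simp add: y residual_succ_def filter_mset_image_mset)
  show ?case
  proof (cases "v \<in> H")
    case True
    then have "residual_succ v = {#}"
      using H_hereditary[of v] by (auto simp: residual_succ_def)
    then have "outside y = {#}" unfolding out by simp
    moreover have "outside x = {#}" using True by (simp add: v)
    ultimately show ?thesis by (simp only: unfold_to_empty) simp
  next
    case False
    then have "residual_succ v \<noteq> {#}" using residual_succ_empty_iff vE ne by simp
    then have "unfold_to residual_succ L (outside x) = unfold_to residual_succ L (outside y)"
      if "i + 1 \<le> L" for L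
      unfolding out using unfold_to_successors[of residual_succ v i L] that False by (simp add: v)
    then show ?thesis by blast
  qed
next
  case (sym x y)
  then show ?case by metis
next
  case (trans x y z)
  then obtain K K' where
    "\<forall>L\<ge>K. unfold_to residual_succ L (outside x) = unfold_to residual_succ L (outside y)"
    "\<forall>L\<ge>K'. unfold_to residual_succ L (outside y) = unfold_to residual_succ L (outside z)"
    by blast
  then show ?case by (intro exI[of _ "max K K'"]) simp
next
  case (mult x y x' y')
  then obtain K K' where
    "\<forall>L\<ge>K. unfold_to residual_succ L (outside x) = unfold_to residual_succ L (outside y)"
    "\<forall>L\<ge>K'. unfold_to residual_succ L (outside x') = unfold_to residual_succ L (outside y')"
    by blast
  then show ?case
    by (intro exI[of _ "max K K'"]) (simp add: free_comm_monoid_def unfold_to_union)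
qed simp

text \<open>
  Unfolding in the residual graph drops the successors in \<open>H\<close>. It therefore changes the class in \<open>T\<^sub>E\<close>
  only by splitting off a summand in \<open>I\<close>; this is recorded by \<open>leads_to\<close>, a preorder compatible
  with sums.
\<close>
definition leads_to :: "('v \<times> int) multiset \<Rightarrow> ('v \<times> int) multiset \<Rightarrow> bool" where
  "leads_to x y \<longleftrightarrow> over (verts E) x \<and> over (verts E) y \<and> (\<exists>h\<in>I. cls x = cls y \<otimes>\<^bsub>T\<^esub> h)"

lemma leads_to_refl: "over (verts E) x \<Longrightarrow> leads_to x x"
  using cls_closed I.one_closed unfolding leads_to_def by (metis T.r_one)

lemma leads_to_trans:
  assumes "leads_to x y" "leads_to y z"
  shows "leads_to x z"
proof -
  obtain h k where *: "h \<in> I" "k \<in> I" "cls x = cls y \<otimes>\<^bsub>T\<^esub> h" "cls y = cls z \<otimes>\<^bsub>T\<^esub> k"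
    and ov: "over (verts E) x" "over (verts E) y" "over (verts E) z"
    using assms by (auto simp: leads_to_def)
  have "cls x = cls z \<otimes>\<^bsub>T\<^esub> (k \<otimes>\<^bsub>T\<^esub> h)"
    unfolding *(3,4) using *(1,2) ov cls_closed ideal_carrier by (intro T.m_assoc) auto
  then show ?thesis using ov * I.m_closed unfolding leads_to_def by blast
qed

lemma leads_to_union:
  assumes "leads_to x y" "leads_to x' y'"
  shows "leads_to (x + x') (y + y')"
proof -
  obtain h k where *: "h \<in> I" "k \<in> I" "cls x = cls y \<otimes>\<^bsub>T\<^esub> h" "cls x' = cls y' \<otimes>\<^bsub>T\<^esub> k"
    and ov: "over (verts E) x" "over (verts E) y" "over (verts E) x'" "over (verts E) y'"
    using assms by (auto simp: leads_to_def)
  have car: "cls y \<in> carrier T" "cls y' \<in> carrier T" "h \<in> carrier T" "k \<in> carrier T"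
    using ov * cls_closed ideal_carrier by auto
  have "cls (x + x') = cls (y + y') \<otimes>\<^bsub>T\<^esub> (h \<otimes>\<^bsub>T\<^esub> k)"
    using car by (simp add: cls_union ov *(3,4) T.m_ac)
  then show ?thesis using ov * I.m_closed unfolding leads_to_def by auto
qed

lemma leads_to_submset:
  assumes "over (verts E) (x + u)" "over H u"
  shows "leads_to (x + u) x"
  using assms cls_union[of x u] cls_in_ideal[of u] unfolding leads_to_def by auto

lemma leads_to_outside:
  assumes "over (verts E) x"
  shows "leads_to x (outside x)"
proof -
  have x: "x = outside x + filter_mset (\<lambda>p. fst p \<in> H) x"
    using multiset_partition[of x "\<lambda>p. fst p \<notin> H"] by simp
  have "leads_to (outside x + filter_mset (\<lambda>p. fst p \<in> H) x) (outside x)"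
    using assms by (intro leads_to_submset) auto
  then show ?thesis using x by simp
qed

lemma leads_to_unfold_step:
  assumes "over (verts E - H) x"
  shows "leads_to x (unfold_step residual_succ x)"
  using assms
proof (induction x)
  case empty
  then show ?case by (simp add: leads_to_refl)
next
  case (add p x)
  obtain v i where p: "p = (v, i)" by fastforce
  have v: "v \<in> verts E" "v \<notin> H" using add.prems by (auto simp: p)
  have "leads_to {#p#} (unfold_step residual_succ {#p#})"
  proof (cases "residual_succ v = {#}")
    case True
    then show ?thesis using v by (simp add: p unfold_step_def leads_to_refl)
  next
    case False
    then have ne: "out_neighbours E v \<noteq> {#}" by (auto simp: residual_succ_def)
    let ?y = "{#(w, i + 1). w \<in># out_neighbours E v#}"
    have "outside ?y = {#(w, i + 1). w \<in># residual_succ v#}"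
      by (simp add: residual_succ_def filter_mset_image_mset)
    then have "outside ?y = unfold_step residual_succ {#p#}"
      using False by (simp add: p unfold_step_def)
    moreover have "leads_to ?y (outside ?y)"
      using out_neighbours_verts by (intro leads_to_outside) (simp add: image_image)
    moreover have "cls {#p#} = cls ?y" using talented_relation[OF v(1) ne] by (simp add: p)
    ultimately show ?thesis using v by (simp add: leads_to_def p)
  qed
  moreover have "leads_to x (unfold_step residual_succ x)" using add by simp
  ultimately show ?case
    using leads_to_union[of "{#p#}" _ x] unfold_step_union[of residual_succ "{#p#}" x] by simp
qed

lemma leads_to_unfold_steps:
  assumes "over (verts E - H) x"
  shows "leads_to x ((unfold_step residual_succ ^^ k) x)"
proof (induction k)
  case 0
  have "over (verts E) x" using assms by blast
  then show ?case by (simp add: leads_to_refl)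
next
  case (Suc k)
  have "over (verts E - H) ((unfold_step residual_succ ^^ k) x)"
    using assms residual_succ_closed by (rule unfold_steps_vertices)
  from leads_to_trans[OF Suc leads_to_unfold_step[OF this]] show ?case by simp
qed

lemma leads_to_unfold_to:
  assumes "over (verts E - H) x"
  shows "leads_to x (unfold_to residual_succ L x)"
  using assms
proof (induction x)
  case empty
  then show ?case by (simp add: leads_to_refl)
next
  case (add p x)
  obtain v i where p: "p = (v, i)" by fastforce
  have "leads_to {#p#} (unfold_to residual_succ L {#p#})"
    unfolding p unfold_to_single using add.prems p by (intro leads_to_unfold_steps) auto
  moreover have "leads_to x (unfold_to residual_succ L x)" using add by simp
  ultimately show ?case
    using leads_to_union[of "{#p#}" _ x] unfold_to_union[of residual_succ L "{#p#}" x] by simp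
qed

lemma leads_to_divides:
  assumes "leads_to x y" "z \<subseteq># y"
  shows "cls z divides\<^bsub>T\<^esub> cls x"
proof -
  obtain u where y: "y = z + u" using assms(2) by (metis mset_subset_eq_exists_conv)
  obtain h where h: "h \<in> I" "cls x = cls y \<otimes>\<^bsub>T\<^esub> h" and "over (verts E) y"
    using assms(1) by (auto simp: leads_to_def)
  then have ov: "over (verts E) z" "over (verts E) u" by (auto simp: y)
  then have "cls x = cls z \<otimes>\<^bsub>T\<^esub> (cls u \<otimes>\<^bsub>T\<^esub> h)"
    using h cls_closed ideal_carrier by (simp add: y cls_union T.m_assoc)
  then show ?thesis
    using ov h cls_closed ideal_carrier by (intro dividesI[of "cls u \<otimes>\<^bsub>T\<^esub> h"]) auto
qed

section \<open>Vertices without exits in the residual graph\<close>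

context
  fixes D
  assumes free: "acts_freely T (talented_act E)"
    and D: "finite D" "D \<subseteq> verts E - H" "\<forall>z\<in>D. \<exists>w\<in>D. residual_succ z = {#w#}"
begin

text \<open>
  By the pigeonhole principle the forward path of \<open>z\<close> enters a cycle of \<open>D\<close>, at a generator \<open>c\<close>. Around
  the cycle, \<open>c\<close> leads to its own shift by the length \<open>p\<close>, up to a summand \<open>h \<in> I\<close>. If \<open>h\<close> were
  trivial, then \<open>c\<close> would be a nontrivial fixed point of the action of \<open>p\<close> on \<open>T\<^sub>E\<close>.
\<close>
lemma exitless_above_ideal:
  assumes "z \<in> D"
  obtains h where "h \<in> I" "h \<noteq> \<one>\<^bsub>T\<^esub>" "h divides\<^bsub>T\<^esub> cls {#(z, t)#}"
proof -
  obtain f where f: "\<forall>z\<in>D. f z \<in> D \<and> residual_succ z = {#f z#}" using D(3) by metis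
  have fD: "(f ^^ k) z \<in> D" for k
    using assms f by (induction k) auto
  have steps: "(unfold_step residual_succ ^^ k) {#((f ^^ j) z, i)#} = {#((f ^^ (k + j)) z, i + int k)#}"
    for k j i
    using f fD by (induction k) (auto simp: unfold_step_def ac_simps)
  have "range (\<lambda>k. (f ^^ k) z) \<subseteq> D" using fD by auto
  then have "finite (range (\<lambda>k. (f ^^ k) z))" using D(1) by (rule finite_subset)
  then have "\<not> inj (\<lambda>k. (f ^^ k) z)" using range_inj_infinite by blast
  then obtain i j where "i \<noteq> j" "(f ^^ i) z = (f ^^ j) z" by (auto simp: inj_def)
  then obtain i p where p: "0 < p" and fp: "(f ^^ (p + i)) z = (f ^^ i) z"
    by (metis add.commute less_imp_add_positive linorder_neqE_nat)
  define c where "c = {#((f ^^ i) z, t + int i)#}"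
  have ov: "over (verts E - H) {#(z, t)#}" "over (verts E - H) c"
    using D(2) fD assms by (auto simp: c_def)
  have zc: "leads_to {#(z, t)#} c"
    using leads_to_unfold_steps[OF ov(1), of i] steps[of i 0 t] by (simp add: c_def)
  have "leads_to c (shift (int p) c)"
    using leads_to_unfold_steps[OF ov(2), of p] steps[of p i "t + int i"] by (simp add: c_def fp)
  then obtain h where h: "h \<in> I" "cls c = cls (shift (int p) c) \<otimes>\<^bsub>T\<^esub> h"
    by (auto simp: leads_to_def)
  have ovc: "over (verts E) c" "over (verts E) (shift (int p) c)"
    using ov(2) by (auto simp: over_shift)
  have "h \<noteq> \<one>\<^bsub>T\<^esub>"
  proof
    assume "h = \<one>\<^bsub>T\<^esub>"
    then have "talented_act E (int p) (cls c) = cls c"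
      using h cls_closed[OF ovc(2)] cls_shift[OF ovc(1)] by simp
    moreover have "cls c \<noteq> \<one>\<^bsub>T\<^esub>"
      using cls_in_ideal[OF ovc(1)] ov(2) I.one_closed by (auto simp: c_def)
    ultimately show False
      using free cls_closed[OF ovc(1)] p unfolding acts_freely_def by (metis of_nat_eq_0_iff less_irrefl)
  qed
  moreover have "h divides\<^bsub>T\<^esub> cls c"
    using h ideal_carrier cls_closed[OF ovc(2)] T.m_comm by (intro dividesI) auto
  then have "h divides\<^bsub>T\<^esub> cls {#(z, t)#}"
    using leads_to_divides[OF zc] ideal_carrier[OF h(1)] by (auto intro: T.divides_trans)
  ultimately show thesis using that h(1) by blast
qed

text \<open>
  Elements of \<open>I\<^sup>\<bottom>\<close> other than \<open>0\<close> lie above no nonzero element of \<open>I\<close>, hence above no generator with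
  vertex in \<open>D\<close>. On the other hand, \<open>D\<close> is closed under residual successors, so that any element
  below \<open>v(0)\<close> that is not in \<open>I\<close> is above such a generator.
\<close>
lemma exitless_in_perp_perp:
  assumes "v \<in> D"
  shows "cls {#(v, 0)#} \<in> perp T (perp T I)"
proof -
  let ?a = "cls {#(v, 0)#}"
  have v: "v \<in> verts E" "v \<notin> H" using assms D(2) by auto
  have a: "?a \<in> carrier T" using v by (intro cls_closed) simp
  have "?a \<noteq> \<one>\<^bsub>T\<^esub>" using cls_vertex_in_ideal[OF v(1)] v(2) I.one_closed by metis
  moreover have "\<not> ?a divides\<^bsub>T\<^esub> b \<and> \<not> b divides\<^bsub>T\<^esub> ?a"
    if b: "b \<in> perp T I" "b \<noteq> \<one>\<^bsub>T\<^esub>" for b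
  proof -
    have bT: "b \<in> carrier T"
      and b_perp: "\<And>h. h \<in> I \<Longrightarrow> h \<noteq> \<one>\<^bsub>T\<^esub> \<Longrightarrow> \<not> h divides\<^bsub>T\<^esub> b"
      using b by (auto simp: perp_def)
    have no_exitless: "\<not> cls {#(z, t)#} divides\<^bsub>T\<^esub> b" if "z \<in> D" for z t
    proof
      assume zb: "cls {#(z, t)#} divides\<^bsub>T\<^esub> b"
      obtain h where h: "h \<in> I" "h \<noteq> \<one>\<^bsub>T\<^esub>" "h divides\<^bsub>T\<^esub> cls {#(z, t)#}"
        using exitless_above_ideal[OF \<open>z \<in> D\<close>] by blast
      then show False
        using b_perp T.divides_trans[OF h(3) zb] ideal_carrier by blast
    qed
    moreover have "\<not> b divides\<^bsub>T\<^esub> ?a"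
    proof
      assume "b divides\<^bsub>T\<^esub> ?a"
      then obtain c where c: "c \<in> carrier T" "?a = b \<otimes>\<^bsub>T\<^esub> c" by (auto elim: dividesE)
      obtain x where x: "over (verts E) x" "b = cls x" using bT by (rule carrier_cls)
      obtain y where y: "over (verts E) y" "c = cls y" using c(1) by (rule carrier_cls)
      have "({#(v, 0)#}, x + y) \<in> talented_cong E"
        using c(2) x y v(1) by (intro cls_eqD) (auto simp: cls_union)
      then obtain L where "unfold_to residual_succ L (outside {#(v, 0)#})
          = unfold_to residual_succ L (outside (x + y))"
        using unfold_to_outside_cong by blast
      then have L: "unfold_to residual_succ L {#(v, 0)#}
          = unfold_to residual_succ L (outside x) + unfold_to residual_succ L (outside y)"
        using v(2) by (simp add: unfold_to_union)
      have "outside x \<noteq> {#}"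
      proof
        assume "outside x = {#}"
        then have "over H x" by auto
        then have "b \<in> I" using cls_in_ideal x by simp
        then show False using b_perp b(2) bT T.divides_refl by blast
      qed
      then obtain z t where zt: "(z, t) \<in># unfold_to residual_succ L (outside x)"
        using unfold_to_nonempty by (metis multiset_nonemptyE prod.exhaust)
      have "over D (unfold_to residual_succ L {#(v, 0)#})"
        using assms D(3) by (intro unfold_to_vertices) fastforce+
      then have "z \<in> D" using zt unfolding L by force
      have "leads_to x (unfold_to residual_succ L (outside x))"
        using leads_to_trans[OF leads_to_outside leads_to_unfold_to] over_outside x(1) by blast
      then have "cls {#(z, t)#} divides\<^bsub>T\<^esub> b"
        unfolding x(2) using zt by (rule leads_to_divides[OF _ mset_subset_eq_single])
      then show False using no_exitless[OF \<open>z \<in> D\<close>] by blast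
    qed
    ultimately show ?thesis using assms by blast
  qed
  ultimately show ?thesis using a unfolding perp_def[of T "perp T I"] by blast
qed

end

end

theorem theorem3p14:
  fixes E :: "('v, 'e) pre_digraph"
    and I :: "('v \<times> int) multiset set set"
  assumes "countable_digraph E"
    and "row_finite E"
    and "regular_order_ideal (talented_monoid E) (talented_act E) I"
    and "acts_freely (talented_monoid E) (talented_act E)"
  shows "acts_freely
           (quot_monoid (talented_monoid E) (ideal_cong (talented_monoid E) I))
           (quot_act (ideal_cong (talented_monoid E) I) (talented_act E))"
proof -
  let ?R = "ideal_cong (talented_monoid E) I"
  interpret talented_ideal E I
    using assms(1-3)
    unfolding talented_ideal_def talented_ideal_axioms_def regular_order_ideal_def by blast
  have R: "monoid_congruence T ?R"
    using T.comm_monoid_axioms I.submonoid_axioms by (rule monoid_congruence_ideal_cong)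
  then have eqR: "equiv (carrier T) ?R" by (simp add: monoid_congruence_def)
  have "n = 0" if A: "A \<in> carrier T // ?R" "A \<noteq> ?R `` {\<one>\<^bsub>T\<^esub>}"
    and fix_A: "quot_act ?R (talented_act E) n A = A" for n A
  proof (rule ccontr)
    assume n: "n \<noteq> 0"
    obtain a where a: "a \<in> carrier T" "A = ?R `` {a}" using A(1) by (auto elim: quotientE)
    obtain x where x: "over (verts E) x" "a = cls x" using a(1) by (rule carrier_cls)
    have "?R `` {talented_act E n a} = ?R `` {a}"
      using quot_act_class[where act = "talented_act E", OF eqR ideal_cong_act a(1)] fix_A a(2) by simp
    then have "(talented_act E n a, a) \<in> ?R"
      using eq_equiv_class[OF _ eqR] a(1) by blast
    then obtain i j where ij: "i \<in> I" "j \<in> I" "talented_act E n a \<otimes>\<^bsub>T\<^esub> i = a \<otimes>\<^bsub>T\<^esub> j"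
      by (auto simp: ideal_cong_def)
    obtain u where u: "over (verts E) u" "i = cls u"
      using ideal_carrier[OF ij(1)] by (rule carrier_cls)
    obtain w where w: "over (verts E) w" "j = cls w"
      using ideal_carrier[OF ij(2)] by (rule carrier_cls)
    have "over H u" "over H w" using cls_in_ideal u w ij(1,2) by auto
    then have uw: "outside u = {#}" "outside w = {#}" by auto
    have "over (verts E) (shift n x)" using x(1) by (simp only: over_shift)
    then have "(shift n x + u, x + w) \<in> talented_cong E"
      using ij(3) x u w by (intro cls_eqD) (auto simp: cls_union cls_shift)
    then obtain K where "\<forall>L\<ge>K. unfold_to residual_succ L (outside (shift n x + u))
        = unfold_to residual_succ L (outside (x + w))"
      using unfold_to_outside_cong by blast
    moreover have "outside (shift n x) = shift n (outside x)"
      by (simp add: shift_def filter_mset_image_mset case_prod_unfold)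
    ultimately have per: "unfold_to residual_succ L (shift n (outside x))
        = unfold_to residual_succ L (outside x)" if "K \<le> L" for L using that uw by simp
    have ne: "outside x \<noteq> {#}"
    proof
      assume "outside x = {#}"
      then have "over H x" by auto
      then have "a \<in> I" using cls_in_ideal x by simp
      then have "(a, \<one>\<^bsub>T\<^esub>) \<in> ?R"
        using a(1) I.one_closed T.m_comm unfolding ideal_cong_def by blast
      then show False using A(2) a(2) equiv_class_eq[OF eqR] by blast
    qed
    obtain D where D: "finite D" "D \<noteq> {}" "D \<subseteq> verts E - H"
      "\<forall>z\<in>D. \<exists>w\<in>D. residual_succ z = {#w#}"
      using finite_exitless_set_of_periodic[OF ne n per over_outside[OF x(1)] residual_succ_closed]
      by blast
    then obtain v where v: "v \<in> D" by blast
    have "cls {#(v, 0)#} \<in> perp T (perp T I)"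
      using assms(4) D(1,3,4) v by (rule exitless_in_perp_perp)
    then have "cls {#(v, 0)#} \<in> I" using assms(3) by (simp add: regular_order_ideal_def)
    then show False using v D(3) cls_vertex_in_ideal by blast
  qed
  then show ?thesis
    unfolding acts_freely_def by (auto simp: quot_monoid_def)
qed

end
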